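(* Let $$(f_1,f_2,f_3,f_4,f_5)=(\mathcal{C}_{12,34,56},\,-\mathcal{C}_{16,23,45},\,\mathcal{C}_{14,26,35},\,-\mathcal{C}_{15,24,36},\,\mathcal{C}_{13,25,46}),$$ polynomials in $\mathbb{C}[x_1,\dots,x_6]$. Then $$5\sigma_1^3-18\sigma_1\sigma_2+27\sigma_3=0$$ in $\mathbb{C}[x_1,\dots,x_6]$, where $\sigma_i=\sigma_i(f_1,f_2,f_3,f_4,f_5)$ is the degree $i$ elementary symmetric function of $f_1,\dots,f_5$.
   Context: For $\{a,b,c,d,e,f\}=\{1,\dots,6\}$, define the polynomial in $\mathbb{C}[x_1,\dots,x_6]$ $$\mathcal{C}_{ab,cd,ef}=\det\begin{bmatrix}1&1&1\\ x_a+x_b & x_c+x_d & x_e+x_f\\ x_ax_b & x_cx_d & x_ex_f\end{bmatrix}.$$ *)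

theory Defs
  imports "HOL-Analysis.Analysis" "HOL-Library.Poly_Mapping"
begin

text \<open>
  The polynomial ring in six variables over the complex numbers: finitely supported maps from
  exponent vectors to coefficients, with convolution as multiplication. The variables are indexed
  by the six-element type \<open>6\<close>, where the numerals \<open>1, \<dots>, 6\<close> are pairwise distinct and exhaust the
  type (and \<open>6 = 0\<close>).
\<close>

type_synonym poly6 = "(6 \<Rightarrow>\<^sub>0 nat) \<Rightarrow>\<^sub>0 complex"

definition X :: "6 \<Rightarrow> poly6" where
  "X i = Poly_Mapping.single (Poly_Mapping.single i 1) 1"

text \<open>
  Total in its indices; of interest only when \<open>a, b, c, d, e, f\<close> is a permutation of
  \<open>1, \<dots>, 6\<close>.
\<close>

definition CC :: "6 \<Rightarrow> 6 \<Rightarrow> 6 \<Rightarrow> 6 \<Rightarrow> 6 \<Rightarrow> 6 \<Rightarrow> poly6" where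
  "CC a b c d e f = det (vector
     [vector [1,         1,         1],
      vector [X a + X b, X c + X d, X e + X f],
      vector [X a * X b, X c * X d, X e * X f]] :: poly6^3^3)"

text \<open>
  The sum ranges over sets of positions, not of values, so repeated list entries count separately.
\<close>

definition elem_sym :: "nat \<Rightarrow> 'a::comm_ring_1 list \<Rightarrow> 'a" where
  "elem_sym k fs = (\<Sum>I | I \<subseteq> {..<length fs} \<and> card I = k. \<Prod>i\<in>I. fs ! i)"

end

theory Submission
  imports Defs
begin

text \<open>
  Take the odd- and even-indexed variables as rows and columns. The matrix of differences
  \<open>x\<^sub>i - x\<^sub>j\<close> has rank at most 2, so its three even diagonal products \<open>p0\<close>, \<open>p1\<close>, \<open>p2\<close> and its three
  odd ones \<open>q0\<close>, \<open>q1\<close>, \<open>q2\<close> have the same sum; they also have the same product, as each triple uses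
  every entry exactly once. The \<open>f\<^sub>i\<close> are integer linear combinations of these six products, and
  under this substitution the cubic expression becomes \<open>27 (q0 q1 q2 - p0 p1 p2)\<close>.
\<close>

lemma elem_sym_0: "elem_sym 0 fs = 1"
proof -
  \<comment> \<open>\<open>card\<close> is 0 on infinite sets as well; boundedness of
    \<open>I\<close> excludes these.\<close>
  have "{I. I \<subseteq> {..<length fs} \<and> card I = 0} = {{}}"
    by (auto dest: finite_subset)
  then show ?thesis
    by (simp add: elem_sym_def)
qed

lemma elem_sym_Suc_Nil: "elem_sym (Suc k) [] = 0"
proof -
  have "{I :: nat set. I \<subseteq> {} \<and> card I = Suc k} = {}"
    by auto
  then show ?thesis
    unfolding elem_sym_def by (simp only: list.size lessThan_0 sum.empty)
qed

text \<open>Split the position sets by whether they contain 0, the position of \<open>f\<close>; the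
  other positions are shifted by \<open>Suc\<close>. Recursion on the list makes
  \<open>elem_sym\<close> computable by rewriting.\<close>

lemma elem_sym_Suc_Cons:
  "elem_sym (Suc k) (f # fs) = elem_sym (Suc k) fs + f * elem_sym k fs"
proof -
  define n where "n = length fs"
  define \<A> where "\<A> j = {I. I \<subseteq> {..<n} \<and> card I = j}" for j
  have fin: "finite (\<A> j)" for j
    by (simp add: \<A>_def)
  have finA: "finite I" if "I \<in> \<A> j" for I j
    using that by (auto simp: \<A>_def intro: finite_subset)
  have inj: "inj_on ((`) Suc) (\<A> j)" "inj_on (\<lambda>I. insert 0 (Suc ` I)) (\<A> j)" for j
    by (auto intro!: inj_onI simp: insert_eq_iff inj_image_eq_iff)
  have prod_shift: "(\<Prod>i\<in>Suc ` I. (f # fs) ! i) = (\<Prod>i\<in>I. fs ! i)" for I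
    by (simp add: prod.reindex)
  have split: "{I. I \<subseteq> {..<Suc n} \<and> card I = Suc k}
      = (`) Suc ` \<A> (Suc k) \<union> (\<lambda>I. insert 0 (Suc ` I)) ` \<A> k" (is "?L = ?R")
  proof (intro equalityI subsetI)
    fix I assume "I \<in> ?L"
    then have I: "I \<subseteq> {..<Suc n}" "card I = Suc k" "finite I"
      by (auto intro: finite_subset)
    define J where "J = {i. Suc i \<in> I}"
    have J: "J \<subseteq> {..<n}" "I - {0} = Suc ` J"
      using I(1) by (auto simp: J_def image_iff) (metis not0_implies_Suc)
    have card_J: "card (Suc ` J) = card J"
      by (simp add: card_image)
    show "I \<in> ?R"
    proof (cases "0 \<in> I")
      case True
      then have "I = insert 0 (Suc ` J)"
        using J(2) by blast
      moreover have "card J = k"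
        using True I J(2) card_J by (metis card_Diff_singleton diff_Suc_1)
      ultimately show ?thesis
        using J(1) by (auto simp: \<A>_def)
    next
      case False
      then have "I = Suc ` J"
        using J(2) by simp
      then show ?thesis
        using I(2) J(1) card_J by (auto simp: \<A>_def)
    qed
  next
    fix I assume "I \<in> ?R"
    then show "I \<in> ?L"
      by (auto simp: \<A>_def card_image card_insert_if finite_subset[of _ "{..<n}"])
  qed
  have "elem_sym (Suc k) (f # fs)
      = (\<Sum>I\<in>(`) Suc ` \<A> (Suc k). \<Prod>i\<in>I. (f # fs) ! i)
        + (\<Sum>I\<in>(\<lambda>I. insert 0 (Suc ` I)) ` \<A> k. \<Prod>i\<in>I. (f # fs) ! i)"
    unfolding elem_sym_def
    by (simp only: length_Cons split flip: n_def, rule sum.union_disjoint) (auto simp: fin)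
  also have "\<dots> = (\<Sum>I\<in>\<A> (Suc k). \<Prod>i\<in>I. fs ! i) + (\<Sum>I\<in>\<A> k. f * (\<Prod>i\<in>I. fs ! i))"
    by (simp add: sum.reindex inj prod_shift finA)
  finally show ?thesis
    by (simp add: elem_sym_def \<A>_def n_def sum_distrib_left)
qed

lemma CC_eq: "CC a b c d e f =
    (X c + X d) * (X e * X f) - (X c * X d) * (X e + X f)
    - (X a + X b) * (X e * X f) + (X a * X b) * (X e + X f)
    + (X a + X b) * (X c * X d) - (X a * X b) * (X c + X d)"
  by (simp add: CC_def det_3 vector_3 algebra_simps)

text \<open>Treating the six products as ring elements constrained only by their sum and product
  keeps the expansion at degree 3, instead of degree 9 in the variables.\<close>

lemma elem_sym_cubic_relation:
  fixes p0 p1 p2 q0 q1 q2 :: "'a::comm_ring_1"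
  assumes "p0 + p1 + p2 = q0 + q1 + q2" and prods: "p0 * p1 * p2 = q0 * q1 * q2"
  defines "fs \<equiv> [p1 - p2, p1 - p0, q1 - p0 - p2, q0 - p0 - p2, q2 - p0 - p2]"
  shows "5 * elem_sym 1 fs ^ 3 - 18 * elem_sym 1 fs * elem_sym 2 fs + 27 * elem_sym 3 fs = 0"
proof -
  \<comment> \<open>Eliminating \<open>q2\<close> turns the next equation into a polynomial identity
    in five free unknowns.\<close>
  have q2: "q2 = p0 + p1 + p2 - q0 - q1"
    using assms(1) by (simp add: algebra_simps)
  have "5 * elem_sym 1 fs ^ 3 - 18 * elem_sym 1 fs * elem_sym 2 fs + 27 * elem_sym 3 fs
      = 27 * (q0 * q1 * q2 - p0 * p1 * p2)"
    unfolding fs_def numeral_3_eq_3 numeral_2_eq_2 One_nat_def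
      elem_sym_Suc_Cons elem_sym_Suc_Nil elem_sym_0 q2
    by (simp add: algebra_simps)
  then show ?thesis
    by (simp add: prods)
qed

theorem theorem10:
  fixes fs :: "poly6 list"
  assumes "fs = [CC 1 2 3 4 5 6, - CC 1 6 2 3 4 5, CC 1 4 2 6 3 5, - CC 1 5 2 4 3 6, CC 1 3 2 5 4 6]"
  shows "5 * elem_sym 1 fs ^ 3 - 18 * elem_sym 1 fs * elem_sym 2 fs + 27 * elem_sym 3 fs = 0"
proof -
  \<comment> \<open>Rows are 1, 3, 5 and columns 2, 4, 6. The cyclic shifts of \<open>2 4 6\<close>
    give \<open>p0\<close>, \<open>p1\<close>, \<open>p2\<close>; the transpositions
    \<open>2 6 4\<close>, \<open>4 2 6\<close>, \<open>6 4 2\<close> give \<open>q0\<close>,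
    \<open>q1\<close>, \<open>q2\<close>.\<close>
  define p where "p i j k = (X 1 - X i) * (X 3 - X j) * (X 5 - X k)" for i j k
  have "fs = [p 4 6 2 - p 6 2 4, p 4 6 2 - p 2 4 6, p 4 2 6 - p 2 4 6 - p 6 2 4,
      p 2 6 4 - p 2 4 6 - p 6 2 4, p 6 4 2 - p 2 4 6 - p 6 2 4]"
    unfolding assms CC_eq p_def by (simp add: algebra_simps)
  moreover have "p 2 4 6 + p 4 6 2 + p 6 2 4 = p 2 6 4 + p 4 2 6 + p 6 4 2"
    by (simp add: p_def algebra_simps)
  moreover have "p 2 4 6 * p 4 6 2 * p 6 2 4 = p 2 6 4 * p 4 2 6 * p 6 4 2"
    by (simp add: p_def mult_ac)
  ultimately show ?thesis
    using elem_sym_cubic_relation[of "p 2 4 6" "p 4 6 2" "p 6 2 4" "p 2 6 4" "p 4 2 6" "p 6 4 2"]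
    by simp
qed

end
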